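(* Let $\alpha,\beta>0$. For each scientific record $\mathbf{x}$ we have: (i) $\mathrm{H}_\alpha(\mathbf{x})=\mathrm{Su}^{\circ_s}_{2}(\mathbf{x})$ with $s(a)=\lfloor a/\alpha\rfloor$; (ii) $\mathrm{H}^\beta(\mathbf{x})=\mathrm{Su}_{\circ_s}^{2}(\mathbf{x})$ with $s(a)=\lceil a/\beta\rceil$.
   Context: Notation: $a\wedge b=\min(a,b)$, $\mathbb{N}=\{1,2,\ldots\}$, $\lfloor\cdot\rfloor$ and $\lceil\cdot\rceil$ are floor and ceiling (with $\lfloor\infty\rfloor=\lceil\infty\rceil=\infty$). A scientific record is a sequence $\mathbf{x}=(x_1,x_2,\ldots)$ with $x_i\in\mathbb{N}\cup\{0\}$, $x_1\ge x_2\ge\ldots$ and $x_1\ge1$. It is identified with the function $i\mapsto x_i$ on $\mathbb{N}$. Let $\mu$ be the counting measure on $2^{\mathbb{N}}$. The indices $\mathrm{H}_\alpha$ and $\mathrm{H}^\beta$ are $$\mathrm{H}_\alpha(\mathbf{x})=\max_k\big\{\lfloor(x_k/\alpha)\wedge\mu(\{i:x_i\ge x_k\})\rfloor\big\}=\max_k\{\lfloor(x_k/\alpha)\wedge k\rfloor\},$$ $$\mathrm{H}^\beta(\mathbf{x})=\big\lceil\max_k\big\{x_k\wedge(\mu(\{i:x_i\ge x_k\})/\beta)\big\}\big\rceil=\lceil\max_k\{x_k\wedge(k/\beta)\}\rceil.$$ For a nondecreasing function $s\colon[0,\infty]\to[0,\infty]$ with $s(0)=0$ let $a\circ_s b=s(a)$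 for $a,b\in[0,\infty]$. The upper $2$-Sugeno integral and lower $2$-Sugeno integral of $\mathbf{x}$ with respect to an operation $\circ$ on $[0,\infty]$ (nondecreasing in each argument, with $0\circ a\le a$) are $$\mathrm{Su}^{\circ}_{2}(\mathbf{x})=\sup_{t\in[0,\infty]}\big\{(t\circ\mathrm{Su}(\mathbf{x}))\wedge\mu(\{i:x_i\ge t\})\big\},\qquad \mathrm{Su}_{\circ}^{2}(\mathbf{x})=\sup_{t\in[0,\infty]}\big\{t\wedge\big(\mu(\{i:x_i\ge t\})\circ\mathrm{Su}(\mathbf{x})\big)\big\},$$ where $\mathrm{Su}(\mathbf{x})=\sup_{t\in[0,\infty]}\{t\wedge\mu(\{i:x_i\ge t\})\}$. *)

theory Defs
  imports "HOL-Analysis.Analysis"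
begin

(* The range [0,\<infinity>] is the type ennreal, on which floor and ceiling are extended by \<infinity> \<mapsto> \<infinity>. *)

definition efloor :: "ennreal \<Rightarrow> ennreal" where
  "efloor a = (if a = \<infinity> then \<infinity> else ennreal (of_int \<lfloor>enn2real a\<rfloor>))"

definition eceiling :: "ennreal \<Rightarrow> ennreal" where
  "eceiling a = (if a = \<infinity> then \<infinity> else ennreal (of_int \<lceil>enn2real a\<rceil>))"

(* Records are indexed from 1; the value x 0 is never used. *)
definition scientific_record :: "(nat \<Rightarrow> nat) \<Rightarrow> bool" where
  "scientific_record x \<longleftrightarrow> antimono_on {1..} x \<and> x 1 \<ge> 1"

definition level_measure :: "(nat \<Rightarrow> nat) \<Rightarrow> ennreal \<Rightarrow> ennreal" where
  "level_measure x t = emeasure (count_space {1..}) {i \<in> {1..}. of_nat (x i) \<ge> t}"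

definition H_lower :: "real \<Rightarrow> (nat \<Rightarrow> nat) \<Rightarrow> ennreal" where
  "H_lower \<alpha> x =
    Max ((\<lambda>k. efloor (min (of_nat (x k) / ennreal \<alpha>) (level_measure x (of_nat (x k))))) ` {1..})"

definition H_upper :: "real \<Rightarrow> (nat \<Rightarrow> nat) \<Rightarrow> ennreal" where
  "H_upper \<beta> x =
    eceiling (Max ((\<lambda>k. min (of_nat (x k)) (level_measure x (of_nat (x k)) / ennreal \<beta>)) ` {1..}))"

(* The sets under Max are finite, since a record takes only finitely many values and the
   k-th element depends on k through x k only. *)
lemma finite_record_image:
  assumes "scientific_record x"
  shows "finite ((\<lambda>k. F (x k)) ` {1..})"
proof -
  have "x ` {1..} \<subseteq> {..x 1}"
    using assms by (auto simp: scientific_record_def monotone_on_def)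
  then have "finite (F ` x ` {1..})"
    by (meson finite_atMost finite_imageI finite_subset)
  then show ?thesis
    by (simp add: image_image)
qed

definition Su :: "(nat \<Rightarrow> nat) \<Rightarrow> ennreal" where
  "Su x = (SUP t. min t (level_measure x t))"

definition admissible_operation :: "(ennreal \<Rightarrow> ennreal \<Rightarrow> ennreal) \<Rightarrow> bool" where
  "admissible_operation f \<longleftrightarrow>
    (\<forall>b. mono (\<lambda>a. f a b)) \<and> (\<forall>a. mono (f a)) \<and> (\<forall>a. f 0 a \<le> a)"

definition Su2_upper :: "(ennreal \<Rightarrow> ennreal \<Rightarrow> ennreal) \<Rightarrow> (nat \<Rightarrow> nat) \<Rightarrow> ennreal" where
  "Su2_upper f x = (SUP t. min (f t (Su x)) (level_measure x t))"

definition Su2_lower :: "(ennreal \<Rightarrow> ennreal \<Rightarrow> ennreal) \<Rightarrow> (nat \<Rightarrow> nat) \<Rightarrow> ennreal" where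
  "Su2_lower f x = (SUP t. min t (f (level_measure x t) (Su x)))"

definition circ :: "(ennreal \<Rightarrow> ennreal) \<Rightarrow> ennreal \<Rightarrow> ennreal \<Rightarrow> ennreal" where
  "circ s a b = s a"

lemma admissible_circ:
  assumes "mono s" "s 0 = 0"
  shows "admissible_operation (circ s)"
  using assms by (auto simp: admissible_operation_def circ_def mono_def)

lemma efloor_mono: "mono efloor"
proof (rule monoI)
  fix a b :: ennreal
  assume "a \<le> b"
  then show "efloor a \<le> efloor b"
    by (cases a; cases b) (auto simp: efloor_def top_unique intro!: ennreal_leI floor_mono)
qed

lemma eceiling_mono: "mono eceiling"
proof (rule monoI)
  fix a b :: ennreal
  assume "a \<le> b"
  then show "eceiling a \<le> eceiling b"
    by (cases a; cases b) (auto simp: eceiling_def top_unique intro!: ennreal_leI ceiling_mono)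
qed

lemma admissible_circ_floor: "admissible_operation (circ (\<lambda>a. efloor (a / ennreal \<alpha>)))"
  by (rule admissible_circ)
    (intro monoI monoD[OF efloor_mono] divide_right_mono_ennreal, assumption, simp add: efloor_def)

lemma admissible_circ_ceiling: "admissible_operation (circ (\<lambda>a. eceiling (a / ennreal \<beta>)))"
  by (rule admissible_circ)
    (intro monoI monoD[OF eceiling_mono] divide_right_mono_ennreal, assumption, simp add: eceiling_def)

end

theory Submission
  imports Defs
begin

text \<open>
  The level set \<open>{i. x i \<ge> t}\<close> changes only when \<open>t\<close> passes a value of the
  record.  Therefore the supremum over all thresholds \<open>t\<close> of an expression in \<open>t\<close> and
  the measure of its level set, if nondecreasing in \<open>t\<close> for a fixed measure and zero for
  measure zero, is attained at a value of the record
  (\<open>Sup_thresholds_eq_Max_record\<close>).  This turns the two Sugeno integrals of order 2 into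
  maxima over \<open>k\<close>, of \<open>min \<lfloor>x k / \<alpha>\<rfloor> \<mu>\<close> and of
  \<open>min (x k) \<lceil>\<mu> / \<beta>\<rceil>\<close> respectively, where \<open>\<mu>\<close> counts the \<open>i\<close> with
  \<open>x i \<ge> x k\<close>.

  Rounding is monotone, so it commutes with finite minima and maxima.  The indices round the whole
  expression and the integrals only one argument of the minimum; the two agree because the other
  argument, a counting measure or a value of the record, is a natural number or infinite and
  therefore fixed by rounding.
\<close>

lemma efloor_of_nat [simp]: "efloor (of_nat n) = of_nat n"
  by (simp add: efloor_def flip: ennreal_of_nat_eq_real_of_nat)

lemma eceiling_of_nat [simp]: "eceiling (of_nat n) = of_nat n"
  by (simp add: eceiling_def flip: ennreal_of_nat_eq_real_of_nat)

lemma efloor_level_measure [simp]: "efloor (level_measure x t) = level_measure x t"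
proof (cases "finite {i \<in> {1..}. of_nat (x i) \<ge> t}")
  case True
  then have "level_measure x t = of_nat (card {i \<in> {1..}. of_nat (x i) \<ge> t})"
    unfolding level_measure_def by (intro emeasure_count_space_finite) auto
  then show ?thesis by simp
next
  case False
  then have "level_measure x t = \<infinity>"
    unfolding level_measure_def by (subst emeasure_count_space_infinite) auto
  then show ?thesis by (simp add: efloor_def)
qed

text \<open>
  Raising a threshold \<open>t\<close> to the least value \<open>x k \<ge> t\<close> of the record keeps its level set,
  and does not decrease \<open>F\<close>.  If no such value exists, then the level set of \<open>t\<close> is empty
  and \<open>t\<close> contributes \<open>F t 0 = 0\<close> to the supremum.
\<close>

lemma Sup_thresholds_eq_Max_record:
  fixes F :: "ennreal \<Rightarrow> ennreal \<Rightarrow> ennreal"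
  assumes x: "scientific_record x"
    and mono: "\<And>m. mono (\<lambda>t. F t m)"
    and zero: "\<And>t. F t 0 = 0"
  shows "(SUP t. F t (level_measure x t)) =
    Max ((\<lambda>k. F (of_nat (x k)) (level_measure x (of_nat (x k)))) ` {1..})"
    (is "?S = Max ?A")
proof (rule antisym)
  have fin: "finite ?A"
    using finite_record_image[OF x, of "\<lambda>v. F (of_nat v) (level_measure x (of_nat v))"] .
  show "?S \<le> Max ?A"
  proof (rule SUP_least)
    fix t :: ennreal
    show "F t (level_measure x t) \<le> Max ?A"
    proof (cases "\<exists>k\<ge>1. of_nat (x k) \<ge> t")
      case False
      then have "{i \<in> {1..}. of_nat (x i) \<ge> t} = {}" by auto
      then have "level_measure x t = 0" by (simp only: level_measure_def emeasure_empty)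
      then show ?thesis by (simp add: zero)
    next
      case True
      then obtain k where k: "k \<ge> 1" "of_nat (x k) \<ge> t"
        and least: "\<And>i. i \<ge> 1 \<Longrightarrow> of_nat (x i) \<ge> t \<Longrightarrow> x k \<le> x i"
        using ex_has_least_nat[of "\<lambda>k. k \<ge> 1 \<and> of_nat (x k) \<ge> t" _ x] by blast
      have "{i \<in> {1..}. of_nat (x i) \<ge> t} = {i \<in> {1..}. of_nat (x i) \<ge> (of_nat (x k) :: ennreal)}"
        using k least by (auto intro: order_trans)
      then have "level_measure x t = level_measure x (of_nat (x k))"
        by (simp only: level_measure_def)
      then have "F t (level_measure x t) \<le> F (of_nat (x k)) (level_measure x (of_nat (x k)))"
        using monoD[OF mono k(2)] by simp
      also have "\<dots> \<le> Max ?A" using fin k(1) by (intro Max_ge) auto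
      finally show ?thesis .
    qed
  qed
  show "Max ?A \<le> ?S"
    using fin by (subst Max_le_iff) (auto intro: SUP_upper)
qed

theorem proposition5p5:
  fixes \<alpha> \<beta> :: real and x :: "nat \<Rightarrow> nat"
  assumes "\<alpha> > 0" and "\<beta> > 0" and "scientific_record x"
  shows "H_lower \<alpha> x = Su2_upper (circ (\<lambda>a. efloor (a / ennreal \<alpha>))) x \<and>
    H_upper \<beta> x = Su2_lower (circ (\<lambda>a. eceiling (a / ennreal \<beta>))) x"
proof
  have mono_floor: "mono (\<lambda>t. min (efloor (t / ennreal \<alpha>)) m)" for m
    by (intro monoI min.mono monoD[OF efloor_mono] divide_right_mono_ennreal) auto
  have "H_lower \<alpha> x = Max ((\<lambda>k. min (efloor (of_nat (x k) / ennreal \<alpha>))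
      (level_measure x (of_nat (x k)))) ` {1..})"
    by (simp add: H_lower_def flip: min_of_mono[OF efloor_mono])
  also have "\<dots> = Su2_upper (circ (\<lambda>a. efloor (a / ennreal \<alpha>))) x"
    unfolding Su2_upper_def circ_def
    by (rule Sup_thresholds_eq_Max_record[OF assms(3) mono_floor, symmetric]) simp
  finally show "H_lower \<alpha> x = Su2_upper (circ (\<lambda>a. efloor (a / ennreal \<alpha>))) x" .

  have mono_min: "mono (\<lambda>t. min t (eceiling (m / ennreal \<beta>)))" for m
    by (intro monoI min.mono) auto
  have fin: "finite ((\<lambda>k. min (of_nat (x k)) (level_measure x (of_nat (x k)) / ennreal \<beta>)) ` {1..})"
    using finite_record_image[OF assms(3),
        of "\<lambda>v. min (of_nat v) (level_measure x (of_nat v) / ennreal \<beta>)"] .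
  have "H_upper \<beta> x = Max ((\<lambda>k. min (of_nat (x k))
      (eceiling (level_measure x (of_nat (x k)) / ennreal \<beta>))) ` {1..})"
    unfolding H_upper_def
    by (subst mono_Max_commute[OF eceiling_mono fin])
      (simp_all add: image_image flip: min_of_mono[OF eceiling_mono])
  also have "\<dots> = Su2_lower (circ (\<lambda>a. eceiling (a / ennreal \<beta>))) x"
    unfolding Su2_lower_def circ_def
    by (rule Sup_thresholds_eq_Max_record[OF assms(3) mono_min, symmetric])
      (simp add: eceiling_def)
  finally show "H_upper \<beta> x = Su2_lower (circ (\<lambda>a. eceiling (a / ennreal \<beta>))) x" .
qed

end
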